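(* For $n\geq 1$ define \[ d_n=\prod_{p\ \text{prime},\ p<n} p^{\max\{t:\ p^t\leq s_p(n)\}}, \] where $s_p(n)=\alpha_0+\alpha_1+\dots+\alpha_r$ is the sum of the digits in the base-$p$ expansion $n=\alpha_0+\alpha_1p+\dots+\alpha_rp^r$. Let $H=\log(\mathrm{e}^{A}\mathrm{e}^{B})\in\mathbb{Q}\langle\langle A,B\rangle\rangle$ be the Baker--Campbell--Hausdorff series. Then for every $n\geq 1$ and every word $w\in\{A,B\}^n$ of length $n$, \[ \mathrm{denom}(\mathrm{coeff}(w,H))\ \big|\ n!\,d_n . \]
   Context: $\mathbb{Q}\langle\langle A,B\rangle\rangle$ is the ring of formal power series in non-commuting variables $A,B$ with rational coefficients, and $H=\log(\mathrm{e}^{A}\mathrm{e}^{B})=\sum_{k\geq1}\frac{(-1)^{k+1}}{k}(\mathrm{e}^{A}\mathrm{e}^{B}-1)^k$, where $\mathrm{e}^{X}=\sum_{m\ge0}X^m/m!$. $\{A,B\}^n$ is the set of words of length $n$ over the alphabet $\{A,B\}$; for a series $X$ and a word $w$, $\mathrm{coeff}(w,X)\in\mathbb{Q}$ is the coefficient of $w$ in $X$. For $r\in\mathbb{Q}$, $\mathrm{denom}(r)$ is the smallest positive integer $d$ with $rd\in\mathbb{Z}$ (so $\mathrm{denom}(0)=1$). *)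

theory Defs
  imports Complex_Main "HOL-Computational_Algebra.Primes"
begin

subsection \<open>Formal power series over \<open>\<rat>\<close> in non-commuting variables\<close>

text \<open>A series over the alphabet \<open>'a\<close> is the family of its coefficients, indexed by words.\<close>

typedef 'a ncps = "UNIV :: ('a list \<Rightarrow> rat) set"
  morphisms coeff_fun Abs_ncps ..

setup_lifting type_definition_ncps

definition ncps_coeff :: "'a list \<Rightarrow> 'a ncps \<Rightarrow> rat" where
  "ncps_coeff w X = coeff_fun X w"

lemma ncps_eqI: "(\<And>w. ncps_coeff w X = ncps_coeff w Y) \<Longrightarrow> X = Y"
  unfolding ncps_coeff_def by transfer auto

instantiation ncps :: (type) ring_1
begin

lift_definition zero_ncps :: "'a ncps" is "\<lambda>w. 0" .

lift_definition one_ncps :: "'a ncps" is "\<lambda>w. if w = [] then 1 else 0" .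

lift_definition plus_ncps :: "'a ncps \<Rightarrow> 'a ncps \<Rightarrow> 'a ncps" is
  "\<lambda>f g w. f w + g w" .

lift_definition minus_ncps :: "'a ncps \<Rightarrow> 'a ncps \<Rightarrow> 'a ncps" is
  "\<lambda>f g w. f w - g w" .

lift_definition uminus_ncps :: "'a ncps \<Rightarrow> 'a ncps" is
  "\<lambda>f w. - f w" .

lift_definition times_ncps :: "'a ncps \<Rightarrow> 'a ncps \<Rightarrow> 'a ncps" is
  "\<lambda>f g w. \<Sum>i\<le>length w. f (take i w) * g (drop i w)" .

instance
proof
  fix a b c :: "'a ncps"
  show "a + b + c = a + (b + c)" by transfer (simp add: add.assoc)
  show "a + b = b + a" by transfer (simp add: add.commute)
  show "0 + a = a" by transfer simp
  show "- a + a = 0" by transfer simp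
  show "a - b = a + - b" by transfer simp
  show "(a + b) * c = a * c + b * c"
    by transfer (simp add: distrib_right sum.distrib)
  show "a * (b + c) = a * b + a * c"
    by transfer (simp add: distrib_left sum.distrib)
  show "(0::'a ncps) \<noteq> 1"
    by transfer (metis zero_neq_one)
  show "1 * a = a"
  proof (transfer, rule ext)
    fix a :: "'a list \<Rightarrow> rat" and w :: "'a list"
    have "(\<Sum>i\<le>length w. (if take i w = [] then 1 else 0) * a (drop i w)) =
          (\<Sum>i\<le>length w. if i = 0 then a w else 0)"
      by (rule sum.cong) auto
    then show "(\<Sum>i\<le>length w. (if take i w = [] then 1 else 0) * a (drop i w)) = a w"
      by simp
  qed
  show "a * 1 = a"
  proof (transfer, rule ext)
    fix a :: "'a list \<Rightarrow> rat" and w :: "'a list"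
    have "(\<Sum>i\<le>length w. a (take i w) * (if drop i w = [] then 1 else 0)) =
          (\<Sum>i\<le>length w. if i = length w then a w else 0)"
      by (rule sum.cong) auto
    then show "(\<Sum>i\<le>length w. a (take i w) * (if drop i w = [] then 1 else 0)) = a w"
      by simp
  qed
  show "a * b * c = a * (b * c)"
  proof (transfer, rule ext)
    fix a b c :: "'a list \<Rightarrow> rat" and w :: "'a list"
    have "(\<Sum>i\<le>length w. (\<Sum>j\<le>length (take i w).
             a (take j (take i w)) * b (drop j (take i w))) * c (drop i w)) =
          (\<Sum>i\<le>length w. \<Sum>j\<le>i. a (take j w) * b (take (i - j) (drop j w)) * c (drop i w))"
      unfolding sum_distrib_right
      by (intro sum.cong) (auto simp: min_def drop_take)
    also have "\<dots> = (\<Sum>j\<le>length w. \<Sum>i\<le>length w - j.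
        a (take j w) * b (take i (drop j w)) * c (drop (i + j) w))"
      unfolding sum.Sigma[OF finite_atMost ballI[OF finite_atMost]]
      by (rule sum.reindex_bij_witness
            [where i = "\<lambda>(j, i). (i + j, j)" and j = "\<lambda>(i, j). (j, i - j)"]) auto
    also have "\<dots> = (\<Sum>i\<le>length w. a (take i w) * (\<Sum>j\<le>length (drop i w).
        b (take j (drop i w)) * c (drop j (drop i w))))"
      unfolding sum_distrib_left
      by (intro sum.cong) (auto simp: mult.assoc)
    finally show "(\<Sum>i\<le>length w. (\<Sum>j\<le>length (take i w).
             a (take j (take i w)) * b (drop j (take i w))) * c (drop i w)) =
        (\<Sum>i\<le>length w. a (take i w) * (\<Sum>j\<le>length (drop i w).
        b (take j (drop i w)) * c (drop j (drop i w))))" .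
  qed
qed

end

lift_definition ncps_var :: "'a \<Rightarrow> 'a ncps" is "\<lambda>x w. if w = [x] then 1 else 0" .

lift_definition ncps_scale :: "rat \<Rightarrow> 'a ncps \<Rightarrow> 'a ncps" is "\<lambda>c f w. c * f w" .

text \<open>
  The infinite sum of a family of series, taken coefficientwise.  It is meaningful if every word
  has a nonzero coefficient in only finitely many members of the family; a coefficient for which
  this fails is set to 0 by the convention for \<^const>\<open>sum\<close>.  Lemmas \<open>ncps_coeff_exp\<close> and
  \<open>ncps_coeff_log\<close> below show that this never happens for the exponential and logarithm used here.
\<close>

lift_definition formal_sum :: "(nat \<Rightarrow> 'a ncps) \<Rightarrow> nat set \<Rightarrow> 'a ncps" is
  "\<lambda>f K w. \<Sum>k\<in>{k\<in>K. f k w \<noteq> 0}. f k w" .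

definition ncps_exp :: "'a ncps \<Rightarrow> 'a ncps" where
  "ncps_exp X = formal_sum (\<lambda>m. ncps_scale (1 / fact m) (X ^ m)) {0..}"

definition ncps_log :: "'a ncps \<Rightarrow> 'a ncps" where
  "ncps_log Y = formal_sum (\<lambda>k. ncps_scale ((-1) ^ (k + 1) / of_nat k) ((Y - 1) ^ k)) {1..}"

datatype letter = Letter_A | Letter_B

definition BCH :: "letter ncps" where
  "BCH = ncps_log (ncps_exp (ncps_var Letter_A) * ncps_exp (ncps_var Letter_B))"

lemma ncps_coeff_zero [simp]: "ncps_coeff w 0 = 0"
  and ncps_coeff_one: "ncps_coeff w 1 = (if w = [] then 1 else 0)"
  and ncps_coeff_add [simp]: "ncps_coeff w (X + Y) = ncps_coeff w X + ncps_coeff w Y"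
  and ncps_coeff_diff [simp]: "ncps_coeff w (X - Y) = ncps_coeff w X - ncps_coeff w Y"
  and ncps_coeff_uminus [simp]: "ncps_coeff w (- X) = - ncps_coeff w X"
  and ncps_coeff_mult: "ncps_coeff w (X * Y) = (\<Sum>i\<le>length w. ncps_coeff (take i w) X * ncps_coeff (drop i w) Y)"
  and ncps_coeff_scale [simp]: "ncps_coeff w (ncps_scale c X) = c * ncps_coeff w X"
  unfolding ncps_coeff_def by (transfer, simp)+

lemma ncps_coeff_var: "ncps_coeff w (ncps_var x) = (if w = [x] then 1 else 0)"
  unfolding ncps_coeff_def by transfer simp

lemma ncps_coeff_formal_sum:
  "ncps_coeff w (formal_sum f K) = (\<Sum>k\<in>{k\<in>K. ncps_coeff w (f k) \<noteq> 0}. ncps_coeff w (f k))"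
  unfolding ncps_coeff_def by transfer simp

lemma ncps_coeff_power_eq_0:
  assumes "ncps_coeff [] X = 0" "length w < m"
  shows "ncps_coeff w (X ^ m) = 0"
  using assms(2)
proof (induction m arbitrary: w)
  case (Suc m)
  have "ncps_coeff (take i w) X * ncps_coeff (drop i w) (X ^ m) = 0" if "i \<le> length w" for i
    using Suc that assms(1) by (cases "i = 0") auto
  then show ?case by (simp add: ncps_coeff_mult del: mult_eq_0_iff)
qed simp

lemma ncps_coeff_exp:
  assumes "ncps_coeff [] X = 0"
  shows "ncps_coeff w (ncps_exp X) = (\<Sum>m\<le>length w. ncps_coeff w (X ^ m) / fact m)"
  unfolding ncps_exp_def ncps_coeff_formal_sum
proof (rule sum.mono_neutral_cong_left)
  show "{k \<in> {0..}. ncps_coeff w (ncps_scale (1 / fact k) (X ^ k)) \<noteq> 0} \<subseteq> {..length w}"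
    using ncps_coeff_power_eq_0[OF assms, of w] by (auto simp: not_less[symmetric])
qed auto

lemma ncps_coeff_log:
  assumes "ncps_coeff [] Y = 1"
  shows "ncps_coeff w (ncps_log Y) =
    (\<Sum>k = 1..length w. (-1) ^ (k + 1) / of_nat k * ncps_coeff w ((Y - 1) ^ k))"
  unfolding ncps_log_def ncps_coeff_formal_sum
proof (rule sum.mono_neutral_cong_left)
  have "ncps_coeff [] (Y - 1) = 0" using assms by (simp add: ncps_coeff_one)
  from ncps_coeff_power_eq_0[OF this, of w]
  show "{k \<in> {1..}. ncps_coeff w (ncps_scale ((-1) ^ (k + 1) / of_nat k) ((Y - 1) ^ k)) \<noteq> 0}
      \<subseteq> {1..length w}"
    by (auto simp: not_less[symmetric])
qed auto

lemma ncps_coeff_Nil_exp: "ncps_coeff [] X = 0 \<Longrightarrow> ncps_coeff [] (ncps_exp X) = 1"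
  by (simp add: ncps_coeff_exp ncps_coeff_one)

lemma ncps_coeff_Nil_exp_mult_exp:
  "ncps_coeff [] (ncps_exp (ncps_var Letter_A) * ncps_exp (ncps_var Letter_B)) = 1"
  by (simp add: ncps_coeff_mult ncps_coeff_Nil_exp ncps_coeff_var)


subsection \<open>Denominators and the numbers \<open>d\<^sub>n\<close>\<close>

definition denom :: "rat \<Rightarrow> nat" where
  "denom r = (LEAST d. d > 0 \<and> r * of_nat d \<in> \<int>)"

text \<open>
  The \<open>i\<close>-th base-\<open>p\<close> digit of \<open>n\<close> is \<open>n div p ^ i mod p\<close>, which vanishes for
  \<open>i > n\<close> if \<open>p \<ge> 2\<close>.
\<close>

definition digit_sum :: "nat \<Rightarrow> nat \<Rightarrow> nat" where
  "digit_sum p n = (\<Sum>i\<le>n. n div p ^ i mod p)"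

definition bch_d :: "nat \<Rightarrow> nat" where
  "bch_d n = (\<Prod>p | prime p \<and> p < n. p ^ Max {t. p ^ t \<le> digit_sum p n})"

lemma digit_sum_expansion:
  fixes a :: "nat \<Rightarrow> nat"
  assumes p: "p \<ge> 2" and a: "\<And>i. i \<le> r \<Longrightarrow> a i < p"
    and n: "n = (\<Sum>i\<le>r. a i * p ^ i)"
  shows "digit_sum p n = (\<Sum>i\<le>r. a i)"
proof -
  define b where "b i = (if i \<le> r then a i else 0)" for i
  have b: "b i < p" for i using a p by (auto simp: b_def)
  have low: "(\<Sum>i<k. b i * p ^ i) < p ^ k" for k
  proof (induction k)
    case (Suc k)
    have "(\<Sum>i<Suc k. b i * p ^ i) < p ^ k + b k * p ^ k" using Suc by simp
    also have "\<dots> = (b k + 1) * p ^ k" by simp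
    also have "\<dots> \<le> p * p ^ k" using b[of k] by (intro mult_right_mono) auto
    finally show ?case by simp
  qed simp
  have ext: "n = (\<Sum>i<m. b i * p ^ i)" if "m > r" for m
  proof -
    have "(\<Sum>i<m. b i * p ^ i) = (\<Sum>i\<le>r. a i * p ^ i)"
      using that by (intro sum.mono_neutral_cong_right) (auto simp: b_def)
    then show ?thesis using n by simp
  qed
  have digit: "n div p ^ i mod p = b i" for i
  proof -
    define m where "m = Suc (max r i)"
    have split: "{..<m} = {..<i} \<union> {i} \<union> {Suc i..<m}" by (auto simp: m_def)
    have "n = (\<Sum>j<m. b j * p ^ j)" by (rule ext) (simp add: m_def)
    also have "\<dots> = (\<Sum>j<i. b j * p ^ j) + b i * p ^ i + (\<Sum>j\<in>{Suc i..<m}. b j * p ^ j)"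
      unfolding split by (subst sum.union_disjoint; auto)+
    also have "(\<Sum>j\<in>{Suc i..<m}. b j * p ^ j) =
        p ^ i * (p * (\<Sum>j\<in>{Suc i..<m}. b j * p ^ (j - Suc i)))"
      unfolding sum_distrib_left
    proof (rule sum.cong[OF refl])
      fix j assume "j \<in> {Suc i..<m}"
      then have "p ^ j = p ^ i * (p * p ^ (j - Suc i))"
        by (metis atLeastLessThan_iff le_add_diff_inverse power_Suc power_add add_Suc_shift)
      then show "b j * p ^ j = p ^ i * (p * (b j * p ^ (j - Suc i)))" by simp
    qed
    finally have "n = (\<Sum>j<i. b j * p ^ j) +
        p ^ i * (b i + p * (\<Sum>j\<in>{Suc i..<m}. b j * p ^ (j - Suc i)))"
      by (simp add: algebra_simps)
    then have "n div p ^ i = b i + p * (\<Sum>j\<in>{Suc i..<m}. b j * p ^ (j - Suc i))"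
      using low[of i] p by simp
    then show ?thesis using b[of i] by simp
  qed
  have "b i = 0" if "i > n" for i
  proof -
    have "n < p ^ i" using that p
      by (metis less_exp less_trans power_mono order_less_le_trans zero_le)
    then show ?thesis using digit[of i] by simp
  qed
  then have "(\<Sum>i\<le>n. b i) = (\<Sum>i\<le>max n r. b i)"
    by (intro sum.mono_neutral_left) auto
  also have "\<dots> = (\<Sum>i\<le>r. a i)"
    by (intro sum.mono_neutral_cong_right) (auto simp: b_def)
  finally show ?thesis by (simp add: digit_sum_def digit)
qed

end

theory Submission
  imports Defs
begin

text \<open>
  Expanding the logarithm, the coefficient of a word of length \<open>n\<close> is a sum of terms
  \<open>\<plusminus> 1 / (k \<cdot> m\<^sub>1! \<cdots> m\<^sub>r!)\<close> with all \<open>m\<^sub>i \<ge> 1\<close>, \<open>m\<^sub>1 + \<dots> + m\<^sub>r = n\<close> and \<open>r \<ge> k\<close>.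
  Each single term becomes an integer after multiplication by \<open>n! d\<^sub>n\<close>.  Indeed, by Legendre's
  formula the \<open>p\<close>-adic valuation of the multinomial coefficient \<open>n! / (m\<^sub>1! \<cdots> m\<^sub>r!)\<close> is
  \<open>(s\<^sub>p(m\<^sub>1) + \<dots> + s\<^sub>p(m\<^sub>r) - s\<^sub>p(n)) / (p - 1) \<ge> (k - s\<^sub>p(n)) / (p - 1)\<close>, and this makes up
  for every power of \<open>p\<close> in \<open>k\<close> beyond the largest one not exceeding \<open>s\<^sub>p(n)\<close>.
\<close>

section \<open>Digit sums and Legendre's formula\<close>

lemma digit_sum_rec:
  assumes "p \<ge> 2"
  shows "digit_sum p n = n mod p + digit_sum p (n div p)"
proof (cases n)
  case 0
  then show ?thesis by (simp add: digit_sum_def)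
next
  case (Suc m)
  have le: "n div p \<le> m"
    using Suc assms div_less_dividend[of p n] by linarith
  \<comment> \<open>The digit sums of \<open>n\<close> and \<open>n div p\<close> run over different
    ranges; the excess digits vanish.\<close>
  have z: "n div p div p ^ i mod p = 0" if "i > n div p" for i
  proof -
    have "n div p < p ^ i"
      using that assms by (metis less_exp less_trans power_mono order_less_le_trans zero_le)
    then show ?thesis by simp
  qed
  have "digit_sum p n = n mod p + (\<Sum>i\<le>m. n div p div p ^ i mod p)"
    unfolding digit_sum_def Suc sum.atMost_Suc_shift by (simp add: div_mult2_eq)
  also have "(\<Sum>i\<le>m. n div p div p ^ i mod p) = digit_sum p (n div p)"
    unfolding digit_sum_def using le z by (intro sum.mono_neutral_right) auto
  finally show ?thesis .
qed

text \<open>Adding 1 turns the trailing digits \<open>p - 1\<close> of \<open>n\<close> into 0 and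
  raises the next digit by 1. There are as many of them as factors \<open>p\<close> in
  \<open>Suc n\<close>, and each costs \<open>p - 1\<close>. The induction strips one trailing digit
  at a time.\<close>

lemma digit_sum_Suc:
  assumes "prime p"
  shows "digit_sum p (Suc n) + (p - 1) * multiplicity p (Suc n) = Suc (digit_sum p n)"
proof (induction n rule: less_induct)
  case (less n)
  have p: "p \<ge> 2" using assms by (rule prime_ge_2_nat)
  show ?case
  proof (cases "p dvd Suc n")
    case False
    then have "Suc n mod p = Suc (n mod p)" "Suc n div p = n div p"
      by (auto simp: mod_Suc div_Suc dvd_eq_mod_eq_0 split: if_splits)
    with False show ?thesis
      by (simp add: digit_sum_rec[OF p, of "Suc n"] digit_sum_rec[OF p, of n]
          not_dvd_imp_multiplicity_0)
  next
    case True
    then obtain q where q: "Suc n = p * q" by blast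
    then obtain m where m: "q = Suc m" by (cases q) auto
    have n: "n = p * m + (p - 1)" using q m p by (simp add: algebra_simps)
    have "(p * m + r) mod p = r" "(p * m + r) div p = m" if "r < p" for r
      using that by simp_all
    from this[of "p - 1"] have "n mod p = p - 1" "n div p = m" using n p by simp_all
    then have 1: "digit_sum p n = p - 1 + digit_sum p m"
      using digit_sum_rec[OF p, of n] by simp
    have 2: "digit_sum p (Suc n) = digit_sum p (Suc m)"
      using digit_sum_rec[OF p, of "Suc n"] p by (simp add: q m)
    have "1 * m \<le> p * m" using p by (intro mult_right_mono) auto
    then have "m < n" using n p by linarith
    from less.IH[OF this]
    have 3: "digit_sum p (Suc m) + (p - 1) * multiplicity p (Suc m) = Suc (digit_sum p m)" .
    have 4: "multiplicity p (Suc n) = Suc (multiplicity p (Suc m))"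
      unfolding q m using p by (intro multiplicity_times_same) auto
    show ?thesis using 1 2 3 4 by (simp add: algebra_simps)
  qed
qed

text \<open>Legendre's formula by telescoping \<open>digit_sum_Suc\<close>; the additive form avoids
  division and truncated subtraction.\<close>

lemma legendre_digit_sum:
  assumes "prime p"
  shows "(p - 1) * multiplicity p (fact n :: nat) + digit_sum p n = n"
proof (induction n)
  case 0
  then show ?case by (simp add: digit_sum_def)
next
  case (Suc n)
  have "multiplicity p (fact (Suc n) :: nat) = multiplicity p (Suc n) + multiplicity p (fact n :: nat)"
    unfolding fact_Suc of_nat_id
    using assms by (intro prime_elem_multiplicity_mult_distrib) auto
  then show ?case using Suc digit_sum_Suc[OF assms, of n] by (simp add: algebra_simps)
qed

lemma digit_sum_pos:
  assumes "p \<ge> 2" "n > 0"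
  shows "digit_sum p n > 0"
  using assms(2)
proof (induction n rule: less_induct)
  case (less n)
  show ?case
  proof (cases "n mod p = 0")
    case True
    then have "n div p > 0" using less.prems by (metis div_mult_mod_eq add_0_right gr0I mult_0)
    moreover have "n div p < n" using less.prems assms(1) by simp
    ultimately show ?thesis using less.IH digit_sum_rec[OF assms(1), of n] by simp
  qed (use digit_sum_rec[OF assms(1), of n] in simp)
qed

text \<open>This is why \<open>bch_d\<close> can omit the primes \<open>p \<ge> n\<close>. For
  \<open>n < p\<close> the digit sum is at most \<open>n\<close>; for \<open>n = p\<close> the
  factor \<open>p\<close> of \<open>fact p\<close> takes \<open>p - 1\<close> away in Legendre's
  formula.\<close>

lemma digit_sum_less:
  assumes "prime p" "n \<le> p"
  shows "digit_sum p n < p"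
proof (cases "n = p")
  case True
  have "p dvd fact p" using assms(1) by (simp add: prime_dvd_fact_iff)
  then have "multiplicity p (fact p :: nat) \<ge> 1"
    using assms(1) by (intro multiplicity_geI) (auto simp: prime_gt_1_nat)
  then have "(p - 1) * multiplicity p (fact p :: nat) \<ge> p - 1" by simp
  with legendre_digit_sum[OF assms(1), of p] prime_ge_2_nat[OF assms(1)]
  show ?thesis unfolding True by linarith
next
  case False
  with legendre_digit_sum[OF assms(1), of n] assms(2) show ?thesis by linarith
qed

section \<open>Valuations of products of factorials\<close>

lemma prod_list_fact_dvd_fact_sum_list:
  "prod_list (map fact ms) dvd (fact (sum_list ms) :: nat)"
proof (induction ms)
  case (Cons m ms)
  then have "prod_list (map fact (m # ms)) dvd fact m * (fact (sum_list ms) :: nat)"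
    by (simp add: mult_dvd_mono)
  also have "\<dots> dvd fact (sum_list (m # ms))" by (simp add: fact_fact_dvd_fact)
  finally show ?case .
qed simp

lemma prod_list_fact_pos: "prod_list (map fact ms) > (0::nat)"
  by (induction ms) auto

text \<open>Legendre's formula for each entry, where a nonzero entry has digit sum at least
  1.\<close>

lemma legendre_prod_list:
  assumes "prime p" "0 \<notin> set ms"
  shows "(p - 1) * multiplicity p (prod_list (map fact ms) :: nat) + length ms \<le> sum_list ms"
  using assms(2)
proof (induction ms)
  case (Cons m ms)
  have "multiplicity p (prod_list (map fact (m # ms)) :: nat) =
      multiplicity p (fact m :: nat) + multiplicity p (prod_list (map fact ms) :: nat)"
    using assms(1) prod_list_fact_pos[of ms]
    by (simp add: prime_elem_multiplicity_mult_distrib)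
  moreover have "digit_sum p m \<ge> 1"
    using digit_sum_pos[of p m] Cons.prems prime_ge_2_nat[OF assms(1)] by auto
  ultimately show ?case
    using Cons legendre_digit_sum[OF assms(1), of m] by (simp add: algebra_simps)
qed simp

text \<open>A Bernoulli-type bound: each further factor \<open>p\<close> adds at least
  \<open>p - 1\<close>, which is the cost of one unit of valuation in Legendre's formula.\<close>

lemma power_add_ge:
  fixes p :: nat
  assumes "p \<ge> 1"
  shows "p ^ t + (p - 1) * j \<le> p ^ (t + j)"
proof (induction j)
  case (Suc j)
  have "(p - 1) * 1 \<le> (p - 1) * p ^ (t + j)" using assms by (intro mult_left_mono) auto
  moreover have "p ^ (t + Suc j) = p ^ (t + j) + (p - 1) * p ^ (t + j)"
    using assms by (simp add: algebra_simps diff_mult_distrib)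
  moreover have "(p - 1) * Suc j = (p - 1) * 1 + (p - 1) * j" by simp
  ultimately show ?case using Suc by linarith
qed simp

text \<open>If \<open>k\<close> has at most \<open>t\<close> factors \<open>p\<close>, integrality
  of the multinomial coefficient suffices. Otherwise \<open>k\<close> is so large that having
  \<open>k\<close> parts forces enough factors \<open>p\<close> into that coefficient.\<close>

lemma multiplicity_prod_list_fact_le:
  assumes p: "prime p" and ms: "0 \<notin> set ms" and k: "0 < k" "k \<le> length ms"
    and t: "digit_sum p (sum_list ms) < p ^ Suc t"
  shows "multiplicity p k + multiplicity p (prod_list (map fact ms)) \<le>
    multiplicity p (fact (sum_list ms) :: nat) + t"
proof -
  define U where "U = multiplicity p (prod_list (map fact ms) :: nat)"
  define V where "V = multiplicity p (fact (sum_list ms) :: nat)"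
  define e where "e = multiplicity p k"
  have p2: "p \<ge> 2" using p by (rule prime_ge_2_nat)
  show ?thesis
  proof (cases "e \<le> t")
    case True
    have "U \<le> V" unfolding U_def V_def
      by (intro dvd_imp_multiplicity_le prod_list_fact_dvd_fact_sum_list) simp
    with True show ?thesis by (simp add: U_def V_def e_def)
  next
    case False
    define j where "j = e - Suc t"
    have e: "e = Suc t + j" using False by (simp add: j_def)
    have "p ^ e \<le> k" using k(1) by (intro dvd_imp_le) (auto simp: e_def multiplicity_dvd)
    with power_add_ge[of p "Suc t" j] p2 have "p ^ Suc t + (p - 1) * j \<le> k" by (simp add: e)
    moreover have "(p - 1) * U + k \<le> (p - 1) * V + digit_sum p (sum_list ms)"
      using legendre_prod_list[OF p ms] legendre_digit_sum[OF p, of "sum_list ms"] k(2)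
      unfolding U_def V_def by linarith
    ultimately have "(p - 1) * U + (p - 1) * j < (p - 1) * V" using t by linarith
    then have "(p - 1) * (U + j) < (p - 1) * V" by (simp only: add_mult_distrib2)
    \<comment> \<open>Strictness matters: it supplies the 1 in \<open>e = Suc t + j\<close>, giving
      \<open>U + e \<le> V + t\<close>.\<close>
    then have "U + j < V" by simp
    then show ?thesis using e by (simp add: U_def V_def e_def)
  qed
qed

section \<open>Divisibility by means of \<open>bch_d\<close>\<close>

lemma bch_d_pos: "bch_d n > 0"
  unfolding bch_d_def by (intro prod_pos) (auto dest: prime_gt_0_nat)

lemma digit_sum_less_power_multiplicity_bch_d:
  assumes "prime p"
  shows "digit_sum p n < p ^ Suc (multiplicity p (bch_d n))"
proof (cases "p < n")
  case True
  define T where "T = {t. p ^ t \<le> digit_sum p n}"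
  have p2: "p \<ge> 2" using assms by (rule prime_ge_2_nat)
  have lt: "t < p ^ t" for t using p2 by (intro power_gt_expt) auto
  \<comment> \<open>Without finiteness \<open>Max T\<close> would be unspecified;
    \<open>t < p ^ t\<close> bounds the exponents.\<close>
  have "finite T"
    by (rule finite_subset[of _ "{..digit_sum p n}"]) (use lt in \<open>auto simp: T_def intro: less_imp_le order_trans\<close>)
  have "Suc (Max T) \<notin> T"
    using Max_ge[OF \<open>finite T\<close>, of "Suc (Max T)"] by auto
  then have "digit_sum p n < p ^ Suc (Max T)" by (simp add: T_def)
  also have "p ^ Max T dvd bch_d n"
    unfolding bch_d_def T_def
    by (rule dvd_prodI[of _ p "\<lambda>p. p ^ Max {t. p ^ t \<le> digit_sum p n}"]) (use True assms in auto)
  then have "Max T \<le> multiplicity p (bch_d n)"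
    using assms bch_d_pos[of n] by (intro multiplicity_geI) (auto simp: prime_gt_1_nat)
  then have "p ^ Suc (Max T) \<le> p ^ Suc (multiplicity p (bch_d n))"
    using p2 by (intro power_increasing) auto
  finally show ?thesis .
next
  case False
  then have "digit_sum p n < p" using digit_sum_less[OF assms] by simp
  also have "p \<le> p ^ Suc (multiplicity p (bch_d n))"
    using prime_gt_0_nat[OF assms] by simp
  finally show ?thesis .
qed

text \<open>One prime at a time, with the exponent of \<open>p\<close> in \<open>bch_d\<close> in
  the role of \<open>t\<close>.\<close>

lemma mult_prod_list_fact_dvd:
  assumes "0 \<notin> set ms" "0 < k" "k \<le> length ms"
  shows "k * prod_list (map fact ms) dvd fact (sum_list ms) * bch_d (sum_list ms)"
proof (rule multiplicity_le_imp_dvd)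
  show "k * prod_list (map fact ms) \<noteq> 0" using assms(2) prod_list_fact_pos[of ms] by simp
next
  fix p :: nat assume p: "prime p"
  show "multiplicity p (k * prod_list (map fact ms)) \<le>
      multiplicity p (fact (sum_list ms) * bch_d (sum_list ms))"
    using multiplicity_prod_list_fact_le[OF p assms digit_sum_less_power_multiplicity_bch_d[OF p]]
      p assms(2) prod_list_fact_pos[of ms] bch_d_pos[of "sum_list ms"]
    by (simp add: prime_elem_multiplicity_mult_distrib)
qed

section \<open>Sums of reciprocals of factorial products\<close>

text \<open>Finite sums of reciprocals 1/(m_1! ... m_r!) over compositions of \<open>n\<close>. Only
  a lower bound \<open>k\<close> on the number of parts is kept, since a factor e^A e^B - 1
  contributes one or two. The signs of the logarithm stay outside.\<close>

inductive fact_combo :: "nat \<Rightarrow> nat \<Rightarrow> rat \<Rightarrow> bool" for k n where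
  zero: "fact_combo k n 0"
| add: "0 \<notin> set ms \<Longrightarrow> k \<le> length ms \<Longrightarrow> sum_list ms = n \<Longrightarrow> fact_combo k n x \<Longrightarrow>
    fact_combo k n (1 / of_nat (prod_list (map fact ms)) + x)"

lemma fact_combo_add: "fact_combo k n x \<Longrightarrow> fact_combo k n y \<Longrightarrow> fact_combo k n (x + y)"
  by (induction rule: fact_combo.induct) (auto simp: add.assoc intro: fact_combo.add)

lemma fact_combo_sum: "(\<And>i. i \<in> I \<Longrightarrow> fact_combo k n (f i)) \<Longrightarrow> fact_combo k n (sum f I)"
  by (induction I rule: infinite_finite_induct) (auto intro: fact_combo.zero fact_combo_add)

lemma fact_combo_single:
  "0 \<notin> set ms \<Longrightarrow> k \<le> length ms \<Longrightarrow> sum_list ms = n \<Longrightarrow>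
    fact_combo k n (1 / of_nat (prod_list (map fact ms)))"
  using fact_combo.add[OF _ _ _ fact_combo.zero] by fastforce

lemma fact_combo_mult:
  assumes "fact_combo k n x" "fact_combo l m y"
  shows "fact_combo (k + l) (n + m) (x * y)"
  using assms(1)
proof (induction rule: fact_combo.induct)
  case zero
  then show ?case by (simp add: fact_combo.zero)
next
  case (add ms x)
  have "fact_combo (k + l) (n + m) (1 / of_nat (prod_list (map fact ms)) * y)"
    using assms(2)
  proof (induction rule: fact_combo.induct)
    case zero
    then show ?case by (simp add: fact_combo.zero)
  next
    case (add ms' y)
    \<comment> \<open>Multiplying two terms concatenates their compositions, so lengths and sums
      add.\<close>
    have "fact_combo (k + l) (n + m) (1 / of_nat (prod_list (map fact (ms @ ms'))))"
      using add \<open>0 \<notin> set ms\<close> \<open>k \<le> length ms\<close> \<open>sum_list ms = n\<close>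
      by (intro fact_combo_single) auto
    from fact_combo_add[OF this add.IH] show ?case by (simp add: algebra_simps)
  qed
  from fact_combo_add[OF this add.IH] show ?case by (simp add: algebra_simps)
qed

text \<open>A composition of a positive number has at least one part.\<close>

lemma fact_combo_pos: "fact_combo 0 n x \<Longrightarrow> n > 0 \<Longrightarrow> fact_combo 1 n x"
proof (induction rule: fact_combo.induct)
  case (add ms x)
  then have "1 \<le> length ms" by (cases ms) auto
  with add show ?case by (intro fact_combo.add) auto
qed (rule fact_combo.zero)

lemma fact_combo_div_Ints:
  assumes "fact_combo k n x" "k > 0"
  shows "x / of_nat k * of_nat (fact n * bch_d n) \<in> \<int>"
  using assms(1)
proof (induction rule: fact_combo.induct)
  case (add ms x)
  obtain c where c: "fact n * bch_d n = k * prod_list (map fact ms) * c"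
    using mult_prod_list_fact_dvd[of ms k] add.hyps assms(2) by (auto simp: dvd_def)
  have "(of_nat (prod_list (map fact ms)) :: rat) \<noteq> 0"
    using prod_list_fact_pos[of ms] by simp
  then have "1 / of_nat (prod_list (map fact ms)) / of_nat k * of_nat (fact n * bch_d n) = (of_nat c :: rat)"
    unfolding c of_nat_mult using assms(2) by (simp add: field_simps)
  then have "(1 / of_nat (prod_list (map fact ms)) + x) / of_nat k * of_nat (fact n * bch_d n)
      = of_nat c + x / of_nat k * of_nat (fact n * bch_d n)"
    by (simp only: add_divide_distrib distrib_right)
  with add.IH show ?case by simp
qed simp

section \<open>Coefficients of exponentials, products and powers\<close>

lemma ncps_coeff_var_power:
  "ncps_coeff w (ncps_var x ^ m) = (if w = replicate m x then 1 else 0)"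
proof (induction m arbitrary: w)
  case 0
  then show ?case by (simp add: ncps_coeff_one)
next
  case (Suc m)
  \<comment> \<open>Only the split after the first letter can contribute.\<close>
  have "ncps_coeff w (ncps_var x ^ Suc m) =
      (\<Sum>i\<le>length w. if i = 1 then (if w = replicate (Suc m) x then 1 else 0) else 0)"
    unfolding power_Suc ncps_coeff_mult Suc.IH ncps_coeff_var
  proof (rule sum.cong[OF refl])
    fix i assume "i \<in> {..length w}"
    then have "take i w = [x] \<and> drop i w = replicate m x \<longleftrightarrow> i = 1 \<and> w = replicate (Suc m) x"
      by (cases w; cases i) auto
    then show "(if take i w = [x] then 1 else 0) * (if drop i w = replicate m x then 1 else 0) =
        (if i = 1 then (if w = replicate (Suc m) x then 1 else 0) else (0::rat))"
      by (auto split: if_splits)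
  qed
  then show ?case by (auto simp: Suc_le_eq)
qed

lemma fact_combo_exp_var: "fact_combo 0 (length w) (ncps_coeff w (ncps_exp (ncps_var x)))"
proof -
  have "fact_combo 0 (length w) (ncps_coeff w (ncps_var x ^ m) / fact m)" for m
  proof (cases "w = replicate m x")
    case True
    \<comment> \<open>Zero parts are forbidden, so exponent 0 is represented by the empty
      composition; hence the bound 0 on the number of parts.\<close>
    have "fact_combo 0 m (1 / of_nat (prod_list (map fact (if m = 0 then [] else [m]))))"
      by (intro fact_combo_single) auto
    also have "1 / of_nat (prod_list (map fact (if m = 0 then [] else [m]))) = 1 / (fact m :: rat)"
      by simp
    finally show ?thesis using True by (simp add: ncps_coeff_var_power)
  qed (simp add: ncps_coeff_var_power fact_combo.zero)
  then show ?thesis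
    by (simp add: ncps_coeff_exp ncps_coeff_var fact_combo_sum)
qed

lemma fact_combo_coeff_mult:
  assumes "\<And>w. fact_combo k (length w) (ncps_coeff w X)"
    and "\<And>w. fact_combo l (length w) (ncps_coeff w Y)"
  shows "fact_combo (k + l) (length w) (ncps_coeff w (X * Y))"
  unfolding ncps_coeff_mult
proof (rule fact_combo_sum)
  fix i assume "i \<in> {..length w}"
  then show "fact_combo (k + l) (length w) (ncps_coeff (take i w) X * ncps_coeff (drop i w) Y)"
    using fact_combo_mult[OF assms(1)[of "take i w"] assms(2)[of "drop i w"]] by simp
qed

lemma fact_combo_coeff_power:
  assumes "\<And>w. fact_combo 1 (length w) (ncps_coeff w X)"
  shows "fact_combo k (length w) (ncps_coeff w (X ^ k))"
proof (induction k arbitrary: w)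
  case 0
  then show ?case
    using fact_combo_single[of "[]" 0 0] by (auto simp: ncps_coeff_one intro: fact_combo.zero)
next
  case (Suc k)
  then show ?case using fact_combo_coeff_mult[OF assms Suc.IH] by simp
qed

section \<open>Denominators and the conclusion\<close>

text \<open>The remainder of \<open>N\<close> modulo \<open>denom r\<close> also clears the
  denominator of \<open>r\<close>, so minimality makes it 0.\<close>

lemma denom_dvd:
  assumes "N > 0" "r * of_nat N \<in> \<int>"
  shows "denom r dvd N"
proof -
  let ?P = "\<lambda>d. d > 0 \<and> r * of_nat d \<in> \<int>"
  have P: "?P (denom r)" unfolding denom_def by (rule LeastI[of ?P N]) (use assms in auto)
  have "r * of_nat (N mod denom r) = r * of_nat N - of_nat (N div denom r) * (r * of_nat (denom r))"
  proof -
    have "(of_nat N :: rat) = of_nat (N div denom r * denom r + N mod denom r)" by simp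
    then show ?thesis unfolding of_nat_add of_nat_mult by (simp add: algebra_simps)
  qed
  then have "r * of_nat (N mod denom r) \<in> \<int>" using P assms(2) by auto
  moreover have "\<not> ?P (N mod denom r)"
    using not_less_Least[of "N mod denom r" ?P] P mod_less_divisor[of "denom r" N]
    unfolding denom_def by blast
  ultimately show ?thesis by (auto simp: dvd_eq_mod_eq_0)
qed

theorem theorem1:
  fixes n :: nat and w :: "letter list"
  assumes "n \<ge> 1" and "length w = n"
  shows "denom (ncps_coeff w BCH) dvd fact n * bch_d n"
proof (rule denom_dvd)
  show "fact n * bch_d n > 0" using bch_d_pos by simp
  define Y where "Y = ncps_exp (ncps_var Letter_A) * ncps_exp (ncps_var Letter_B)"
  have Y0: "ncps_coeff [] Y = 1" unfolding Y_def by (rule ncps_coeff_Nil_exp_mult_exp)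
  have Y: "fact_combo 0 (length v) (ncps_coeff v Y)" for v
    using fact_combo_coeff_mult[OF fact_combo_exp_var fact_combo_exp_var] by (simp add: Y_def)
  \<comment> \<open>Subtracting 1 removes the coefficient of the empty word, the only one whose
    composition may have no part. Hence a \<open>k\<close>-th power has at least \<open>k\<close>
    parts.\<close>
  have Y1: "fact_combo 1 (length v) (ncps_coeff v (Y - 1))" for v
    using fact_combo_pos[OF Y[of v]] by (cases "v = []") (auto simp: ncps_coeff_one Y0 intro: fact_combo.zero)
  \<comment> \<open>The sign is split off, so that \<open>fact_combo_div_Ints\<close> applies to
    each \<open>k\<close> with the divisor equal to the bound on the number of parts.\<close>
  have "ncps_coeff w BCH * of_nat (fact n * bch_d n) =
      (\<Sum>k = 1..n. (-1) ^ (k + 1) * (ncps_coeff w ((Y - 1) ^ k) / of_nat k * of_nat (fact n * bch_d n)))"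
    unfolding BCH_def Y_def[symmetric] ncps_coeff_log[OF Y0] assms(2) sum_distrib_right
    by (intro sum.cong) simp_all
  also have "\<dots> \<in> \<int>"
  proof (rule Ints_sum, rule Ints_mult)
    fix k assume "k \<in> {1..n}"
    then show "ncps_coeff w ((Y - 1) ^ k) / of_nat k * of_nat (fact n * bch_d n) \<in> \<int>"
      using fact_combo_coeff_power[OF Y1, of k w] assms(2) by (intro fact_combo_div_Ints) auto
  qed auto
  finally show "ncps_coeff w BCH * of_nat (fact n * bch_d n) \<in> \<int>" .
qed

end
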